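(* Let $\mathcal G=(\mathcal V,\mathcal E,\omega)$ be a connected weighted hypergraph, let $\mathbf G$, $\mathbf A_\theta$, $a_{\min}$, $\phi$, $\mathcal S_\phi$, $\mathbf Q_\phi$ be as defined in the context, and let $\{\mathbf S_D(t)\}_{t\ge 0}$ be the diffusion semiflow on $\mathcal X=\mathbb R^{n\times d}$ generated by $$\frac{d\mathbf X(t)}{dt}=-\mathbf G^\top \mathbf A_\theta(\mathbf X(t))\,\mathbf G\,\mathbf X(t),\qquad \mathbf X(0)=\mathbf X_0 .$$ Let $\mathbf L_H\in\mathbb R^{n\times n}$ be a symmetric positive semidefinite matrix with $\mathbf L_H\phi=0$ and $\ker(\mathbf L_H)=\operatorname{span}\{\phi\}$, and let $$\mathcal E_\phi(\mathbf X):=\tfrac12\langle \mathbf Q_\phi\mathbf X,\mathbf L_H\mathbf Q_\phi\mathbf X\rangle_F .$$ Then the Dirichlet energy of the diffusion semiflow converges to zero. More precisely, for every $\mathbf X_0\in\mathcal X$, $$\mathcal E_\phi(\mathbf S_D(t)\mathbf X_0)\le\tfrac12\lambda_{\max}(\mathbf L_H)\,e^{-2\gamma_D t}\,\|\mathbf Q_\phi\mathbf X_0\|_F^2,\qquad t\ge0,$$ where $\gamma_D:=a_{\min}\lambda_2>0$ and $\lambda_2:=\min_{\mathbf Z\in\mathcal S_\phi^\perp,\ \|\mathbf Z\|_F=1}\|\mathbf G\mathbf Z\|_F^2>0$; and, as $t\to\infty$, $$\mathcal E_\phi(\mathbf S_D(t)\mathbf X_0)\to0\iff\operatorname{dist}(\mathbf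 S_D(t)\mathbf X_0,\mathcal S_\phi)\to0 .$$
   Context: Hypergraph. $\mathcal V$ is a finite set of $n\ge 2$ nodes, $\mathcal E$ a finite set of hyperedges, each $e\in\mathcal E$ being a subset of $\mathcal V$ with $|e|\ge 2$, and $\omega_e>0$ is the weight of $e$. The degree of $v$ is $d_v=\#\{e\in\mathcal E: v\in e\}$ (unweighted) and $d_{\max}=\max_v d_v$. The hypergraph is connected if any two nodes can be joined by a finite sequence of nodes in which consecutive nodes lie in a common hyperedge; then $d_v\ge 1$ for all $v$. The incidence set is $\mathcal I=\{(e,v): e\in\mathcal E, v\in e\}$ and $N=|\mathcal I|$. Phase space. $\mathcal X=\mathbb R^{n\times d}$ with Frobenius inner product $\langle\cdot,\cdot\rangle_F$ and norm $\|\cdot\|_F$; row $\mathbf X_v$ of $\mathbf X$ is the representation of node $v$. $\operatorname{dist}(\mathbf X,\mathcal S)=\inf_{\mathbf Y\in\mathcal S}\|\mathbf X-\mathbf Y\|_F$. $\lambda_{\max}(\cdot)$ is the largest eigenvalue of a symmetric matrix. Gradient matrix. $\mathbf G\in\mathbb R^{N\times n}$ is $\mathbf G=\mathbf\Omega_{\mathcal I}^{1/2}\mathbf P$, where $\mathbf\Omega_{\mathcal I}=\operatorname{diag}(\omega_e)_{(e,v)\in\mathcal I}$ and $(\mathbf P\mathbf f)(e,v)=\frac{\mathbf f(v)}{\sqrt{d_v}}-\frac1{|e|}\sum_{u\in e}\frac{\mathbf f(u)}{\sqrt{d_u}}$; it acts on $\mathbf X\in\mathcal X$ columnwise. Modulation.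 Fix parameters $\theta$ and $0<\varepsilon<1$. For $\mathbf X\in\mathcal X$ let $\mathbf X_e=\operatorname{Agg}(\{\mathbf X_u:u\in e\})\in\mathbb R^d$, with $\operatorname{Agg}$ a permutation-invariant, locally Lipschitz aggregator (such as mean or max pooling), and $r^\theta_{(e,v)}=\sigma(\operatorname{MLP}_\theta(\mathbf X_v\,\|\,\mathbf X_e))\in\mathbb R$, where $\|$ is concatenation, $\sigma$ is LeakyReLU and $\operatorname{MLP}_\theta:\mathbb R^{2d}\to\mathbb R$ is a (locally Lipschitz) multilayer perceptron. Set $$a_\theta(\mathbf X_v,\mathbf X_e)=(1-\varepsilon)\frac{\exp(r^\theta_{(e,v)})}{\sum_{e'\ni v}\exp(r^\theta_{(e',v)})}+\frac{\varepsilon}{d_v},\qquad \mathbf A_\theta(\mathbf X)=\operatorname{diag}(a_\theta(\mathbf X_v,\mathbf X_e))_{(e,v)\in\mathcal I}\in\mathbb R^{N\times N},\qquad a_{\min}:=\varepsilon/d_{\max}.$$ Null mode. $\mathbf D_v=\operatorname{diag}(d_v)_{v\in\mathcal V}$, $\phi=\mathbf D_v^{1/2}\mathbf 1\in\mathbb R^n$, $\mathcal S_\phi=\{\phi c: c\in\mathbb R^{1\times d}\}\subset\mathcal X$; $\mathcal S_\phi^\perp$ is its orthogonal complement in $\mathcal X$, $\mathbf\Pi_\phi$ the orthogonal projector onto $\mathcal S_\phi$, and $\mathbf Q_\phi=\mathbf I-\mathbf\Pi_\phi$. Semiflow. It is known that for every $\mathbf X_0\in\mathcal X$ the diffusion equation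 has a unique global classical ($C^1$ on $[0,\infty)$) solution $\mathbf X(t;\mathbf X_0)$, and $\mathbf S_D(t)\mathbf X_0:=\mathbf X(t;\mathbf X_0)$ defines a continuous semiflow on $\mathcal X$. *)

theory Defs
  imports "HOL-Analysis.Analysis" "HOL-Library.Multiset"
begin

subsection \<open>Matrices\<close>

text \<open>
  Vectors and matrices are indexed by finite types. A feature matrix in $R^{n \times d}$ has type
  \<^typ>\<open>real^'d^'v\<close>; the library's inner product and norm on this type are the Frobenius ones.
\<close>

definition diag_mat :: "('k::finite \<Rightarrow> real) \<Rightarrow> real^'k^'k" where
  "diag_mat c = (\<chi> i j. if i = j then c i else 0)"

definition eigenvalue :: "real^'k^'k \<Rightarrow> real \<Rightarrow> bool" where
  "eigenvalue M l \<longleftrightarrow> (\<exists>x. x \<noteq> 0 \<and> M *v x = l *\<^sub>R x)"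

text \<open>Intended for symmetric matrices, whose eigenvalues are all real.\<close>

definition lambda_max :: "real^'k^'k \<Rightarrow> real" where
  "lambda_max M = Max {l. eigenvalue M l}"

definition orthogonal_projector :: "'a::euclidean_space set \<Rightarrow> 'a \<Rightarrow> 'a" where
  "orthogonal_projector W x = (THE y. y \<in> W \<and> x - y \<in> orthogonal_comp W)"


subsection \<open>Hypergraphs\<close>

text \<open>
  The node set is the whole type \<^typ>\<open>'v\<close>; hyperedges are sets of nodes (so there are no parallel
  hyperedges), and the hyperedge set is finite because \<^typ>\<open>'v\<close> is.
\<close>

definition weighted_hypergraph :: "'v::finite set set \<Rightarrow> ('v set \<Rightarrow> real) \<Rightarrow> bool" where
  "weighted_hypergraph E \<omega> \<longleftrightarrow>
     CARD('v) \<ge> 2 \<and> (\<forall>e\<in>E. card e \<ge> 2) \<and> (\<forall>e\<in>E. \<omega> e > 0)"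

definition connected_hypergraph :: "'v::finite set set \<Rightarrow> bool" where
  "connected_hypergraph E \<longleftrightarrow>
     (\<forall>u v. (u, v) \<in> {(x, y). \<exists>e\<in>E. x \<in> e \<and> y \<in> e}\<^sup>*)"

definition degree :: "'v::finite set set \<Rightarrow> 'v \<Rightarrow> nat" where
  "degree E v = card {e \<in> E. v \<in> e}"

definition max_degree :: "'v::finite set set \<Rightarrow> nat" where
  "max_degree E = Max (range (degree E))"

definition incidences :: "'v::finite set set \<Rightarrow> ('v set \<times> 'v) set" where
  "incidences E = {(e, v). e \<in> E \<and> v \<in> e}"


subsection \<open>Gradient matrix\<close>

text \<open>
  Matrices with one row per incidence need an index type with exactly $N$ elements. It is a type
  variable \<^typ>\<open>'i\<close> together with a bijection \<open>inc\<close> from \<^typ>\<open>'i\<close> onto the incidence set; \<open>inc i\<close> is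
  the incidence belonging to row \<open>i\<close>.
\<close>

definition P_op ::
    "'v::finite set set \<Rightarrow> ('i::finite \<Rightarrow> 'v set \<times> 'v) \<Rightarrow> real^'v \<Rightarrow> real^'i" where
  "P_op E inc f = (\<chi> i. let (e, v) = inc i in
     f $ v / sqrt (degree E v) - (1 / card e) * (\<Sum>u\<in>e. f $ u / sqrt (degree E u)))"

definition gradient_matrix ::
    "'v::finite set set \<Rightarrow> ('v set \<Rightarrow> real) \<Rightarrow> ('i::finite \<Rightarrow> 'v set \<times> 'v) \<Rightarrow> real^'v^'i" where
  "gradient_matrix E \<omega> inc = diag_mat (\<lambda>i. sqrt (\<omega> (fst (inc i)))) ** matrix (P_op E inc)"


subsection \<open>Null mode\<close>

definition null_mode :: "'v::finite set set \<Rightarrow> real^'v" where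
  "null_mode E = diag_mat (\<lambda>v. sqrt (degree E v)) *v 1"

definition null_space :: "'v::finite set set \<Rightarrow> (real^'d::finite^'v) set" where
  "null_space E = range (\<lambda>c. \<chi> v k. null_mode E $ v * c $ k)"

definition Q_proj :: "'v::finite set set \<Rightarrow> real^'d::finite^'v \<Rightarrow> real^'d^'v" where
  "Q_proj E X = X - orthogonal_projector (null_space E) X"

text \<open>
  The minimum depends on the number $d$ of columns of \<open>Z\<close>, hence the type argument. The \<open>LEAST\<close>
  is over a set of reals: it is an attained minimum, not merely an infimum.
\<close>

definition lambda2 ::
    "'d::finite itself \<Rightarrow> 'v::finite set set \<Rightarrow> ('v set \<Rightarrow> real) \<Rightarrow> ('i::finite \<Rightarrow> 'v set \<times> 'v) \<Rightarrow> real"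
  where
  "lambda2 _ E \<omega> inc =
     (LEAST m. m \<in> (\<lambda>Z. (norm (gradient_matrix E \<omega> inc ** Z))\<^sup>2) `
        {Z \<in> orthogonal_comp (null_space E :: (real^'d^'v) set). norm Z = 1})"

definition dirichlet_energy ::
    "'v::finite set set \<Rightarrow> real^'v^'v \<Rightarrow> real^'d::finite^'v \<Rightarrow> real" where
  "dirichlet_energy E L X = 1/2 * (Q_proj E X \<bullet> (L ** Q_proj E X))"


subsection \<open>Multilayer perceptrons\<close>

definition locally_lipschitz :: "('a::metric_space \<Rightarrow> 'b::metric_space) \<Rightarrow> bool" where
  "locally_lipschitz f \<longleftrightarrow> (\<forall>x. \<exists>r>0. \<exists>C. C-lipschitz_on (ball x r) f)"

definition leaky_relu :: "real \<Rightarrow> real \<Rightarrow> real" where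
  "leaky_relu \<alpha> x = (if x \<ge> 0 then x else \<alpha> * x)"

definition concat_vec :: "real^'d::finite \<Rightarrow> real^'d \<Rightarrow> real^('d + 'd)" where
  "concat_vec x y = (\<chi> i. case i of Inl j \<Rightarrow> x $ j | Inr j \<Rightarrow> y $ j)"

text \<open>
  A dense layer is a list of neurons, each given by its weights and its bias. The input layer
  reads a vector in \<^typ>\<open>real^'k\<close>, the subsequent layers read lists of reals, and the activation
  \<open>\<psi> j\<close> is applied componentwise to the output of the \<open>j\<close>-th layer before the next one. The
  last layer has a single neuron and no activation.
\<close>

type_synonym 'k mlp_params = "((real^'k) \<times> real) list \<times> (real list \<times> real) list list"

definition dense :: "(real list \<times> real) list \<Rightarrow> real list \<Rightarrow> real list" where
  "dense l h = map (\<lambda>(w, b). (\<Sum>j<length h. w ! j * h ! j) + b) l"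

fun forward :: "(nat \<Rightarrow> real \<Rightarrow> real) \<Rightarrow> (real list \<times> real) list list \<Rightarrow> real list \<Rightarrow> real list" where
  "forward \<psi> [] h = h"
| "forward \<psi> (l # ls) h = forward (\<lambda>j. \<psi> (Suc j)) ls (dense l (map (\<psi> 0) h))"

definition mlp :: "(nat \<Rightarrow> real \<Rightarrow> real) \<Rightarrow> 'k::finite mlp_params \<Rightarrow> real^'k \<Rightarrow> real" where
  "mlp \<psi> \<theta> x = hd (forward \<psi> (snd \<theta>) (map (\<lambda>(w, b). w \<bullet> x + b) (fst \<theta>)))"

fun compatible_layers :: "nat \<Rightarrow> (real list \<times> real) list list \<Rightarrow> bool" where
  "compatible_layers m [] \<longleftrightarrow> m = 1"
| "compatible_layers m (l # ls) \<longleftrightarrow> (\<forall>(w, b)\<in>set l. length w = m) \<and> compatible_layers (length l) ls"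

definition wf_mlp_params :: "'k::finite mlp_params \<Rightarrow> bool" where
  "wf_mlp_params \<theta> \<longleftrightarrow> compatible_layers (length (fst \<theta>)) (snd \<theta>)"


subsection \<open>Modulation\<close>

text \<open>
  An aggregator is a function of the multiset of node representations, which makes it
  permutation invariant. Local Lipschitz continuity refers to it as a function of the
  tuple of representations of the nodes in a set \<open>e\<close>.
\<close>

definition aggregate ::
    "((real^'d) multiset \<Rightarrow> real^'d) \<Rightarrow> real^'d::finite^'v::finite \<Rightarrow> 'v set \<Rightarrow> real^'d" where
  "aggregate agg X e = agg (image_mset (\<lambda>u. X $ u) (mset_set e))"

definition locally_lipschitz_aggregator ::
    "'v::finite itself \<Rightarrow> ((real^'d::finite) multiset \<Rightarrow> real^'d) \<Rightarrow> bool" where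
  "locally_lipschitz_aggregator _ agg \<longleftrightarrow>
     (\<forall>e::'v set. locally_lipschitz (\<lambda>X :: real^'d^'v. aggregate agg X e))"

definition incidence_score ::
    "real \<Rightarrow> (real^('d + 'd) \<Rightarrow> real) \<Rightarrow> ((real^'d) multiset \<Rightarrow> real^'d) \<Rightarrow>
     real^'d::finite^'v::finite \<Rightarrow> 'v set \<Rightarrow> 'v \<Rightarrow> real" where
  "incidence_score \<alpha> F agg X e v = leaky_relu \<alpha> (F (concat_vec (X $ v) (aggregate agg X e)))"

definition modulation ::
    "'v::finite set set \<Rightarrow> real \<Rightarrow> real \<Rightarrow> (real^('d + 'd) \<Rightarrow> real) \<Rightarrow>
     ((real^'d) multiset \<Rightarrow> real^'d) \<Rightarrow> real^'d::finite^'v \<Rightarrow> 'v set \<Rightarrow> 'v \<Rightarrow> real" where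
  "modulation E \<epsilon> \<alpha> F agg X e v =
     (1 - \<epsilon>) * (exp (incidence_score \<alpha> F agg X e v) /
                (\<Sum>e'\<in>{e'\<in>E. v \<in> e'}. exp (incidence_score \<alpha> F agg X e' v)))
     + \<epsilon> / degree E v"

definition modulation_matrix ::
    "'v::finite set set \<Rightarrow> ('i::finite \<Rightarrow> 'v set \<times> 'v) \<Rightarrow> real \<Rightarrow> real \<Rightarrow> (real^('d + 'd) \<Rightarrow> real) \<Rightarrow>
     ((real^'d) multiset \<Rightarrow> real^'d) \<Rightarrow> real^'d::finite^'v \<Rightarrow> real^'i^'i" where
  "modulation_matrix E inc \<epsilon> \<alpha> F agg X =
     diag_mat (\<lambda>i. modulation E \<epsilon> \<alpha> F agg X (fst (inc i)) (snd (inc i)))"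

definition a_min :: "'v::finite set set \<Rightarrow> real \<Rightarrow> real" where
  "a_min E \<epsilon> = \<epsilon> / max_degree E"

definition gamma_D ::
    "'d::finite itself \<Rightarrow> 'v::finite set set \<Rightarrow> ('v set \<Rightarrow> real) \<Rightarrow> ('i::finite \<Rightarrow> 'v set \<times> 'v) \<Rightarrow>
     real \<Rightarrow> real" where
  "gamma_D d E \<omega> inc \<epsilon> = a_min E \<epsilon> * lambda2 d E \<omega> inc"


subsection \<open>Diffusion semiflow\<close>

definition diffusion_field ::
    "'v::finite set set \<Rightarrow> ('v set \<Rightarrow> real) \<Rightarrow> ('i::finite \<Rightarrow> 'v set \<times> 'v) \<Rightarrow> real \<Rightarrow> real \<Rightarrow>
     (real^('d + 'd) \<Rightarrow> real) \<Rightarrow> ((real^'d) multiset \<Rightarrow> real^'d) \<Rightarrow>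
     real^'d::finite^'v \<Rightarrow> real^'d^'v" where
  "diffusion_field E \<omega> inc \<epsilon> \<alpha> F agg X =
     - (transpose (gradient_matrix E \<omega> inc) **
        (modulation_matrix E inc \<epsilon> \<alpha> F agg X ** (gradient_matrix E \<omega> inc ** X)))"

text \<open>The last conjunct says that the derivative is continuous, so solutions are $C^1$ on $[0,\infty)$.\<close>

definition classical_solution ::
    "('a::real_normed_vector \<Rightarrow> 'a) \<Rightarrow> 'a \<Rightarrow> (real \<Rightarrow> 'a) \<Rightarrow> bool" where
  "classical_solution f x0 x \<longleftrightarrow>
     x 0 = x0 \<and>
     (\<forall>t\<ge>0. (x has_vector_derivative f (x t)) (at t within {0..})) \<and>
     continuous_on {0..} (\<lambda>t. f (x t))"

definition continuous_semiflow :: "(real \<Rightarrow> 'a::topological_space \<Rightarrow> 'a) \<Rightarrow> bool" where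
  "continuous_semiflow S \<longleftrightarrow>
     (\<forall>x. S 0 x = x) \<and>
     (\<forall>s\<ge>0. \<forall>t\<ge>0. \<forall>x. S (s + t) x = S s (S t x)) \<and>
     continuous_on ({0..} \<times> UNIV) (\<lambda>(t, x). S t x)"

definition semiflow_generated_by ::
    "('a::real_normed_vector \<Rightarrow> 'a) \<Rightarrow> (real \<Rightarrow> 'a \<Rightarrow> 'a) \<Rightarrow> bool" where
  "semiflow_generated_by f S \<longleftrightarrow>
     continuous_semiflow S \<and> (\<forall>x0. classical_solution f x0 (\<lambda>t. S t x0))"

end

theory Submission
  imports Defs
begin

text \<open>
  By connectedness the kernel of \<open>G\<close> is exactly the null space, so \<open>G X = G Q X\<close> and
  \<open>\<lambda>\<^sub>2 > 0\<close> by compactness. The modulation is at least \<open>a_min\<close>, hence along a solution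
  the derivative of the squared norm of \<open>Q X\<close> is
  \<open>-2 \<langle>G Q X, A G Q X\<rangle> \<le> -2 a_min \<lambda>\<^sub>2 |Q X|^2\<close>, and the norm decays exponentially.
  Both the energy, by the Rayleigh bound, and the distance to the null space are dominated by the
  norm of \<open>Q X\<close>, so the two sides of the final equivalence both hold unconditionally.
\<close>


subsection \<open>Orthogonal projection\<close>

text \<open>Two candidates differ by a vector lying both in \<open>W\<close> and in its orthogonal
  complement, hence orthogonal to itself. This gives access to the definite description.\<close>

lemma orthogonal_projector_unique:
  assumes "subspace W" "y \<in> W" "x - y \<in> orthogonal_comp W"
  shows "orthogonal_projector W x = y"
  unfolding orthogonal_projector_def
proof (rule the_equality)
  show "y \<in> W \<and> x - y \<in> orthogonal_comp W"
    using assms by simp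
next
  fix z assume z: "z \<in> W \<and> x - z \<in> orthogonal_comp W"
  then have "z - y \<in> W"
    using assms subspace_diff by blast
  moreover have "(x - y) - (x - z) \<in> orthogonal_comp W"
    using z assms(3) subspace_orthogonal_comp subspace_diff by blast
  ultimately have "orthogonal (z - y) (z - y)"
    by (auto simp: orthogonal_comp_def)
  then show "z = y"
    by (simp add: orthogonal_self)
qed

text \<open>The sum of \<open>W\<close> and its complement is the whole space, which supplies a
  candidate; uniqueness identifies it with the projector.\<close>

lemma
  assumes "subspace W"
  shows orthogonal_projector_in: "orthogonal_projector W x \<in> W"
    and orthogonal_projector_residual: "x - orthogonal_projector W x \<in> orthogonal_comp W"
proof -
  have "x \<in> W + orthogonal_comp W"
    using subspace_sum_orthogonal_comp[OF assms] by simp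
  then obtain y z where "y \<in> W" "z \<in> orthogonal_comp W" "x = y + z"
    by (auto elim: set_plus_elim)
  then have "y \<in> W \<and> x - y \<in> orthogonal_comp W"
    by simp
  then show "orthogonal_projector W x \<in> W" "x - orthogonal_projector W x \<in> orthogonal_comp W"
    using orthogonal_projector_unique[OF assms] by auto
qed

lemma linear_orthogonal_projector:
  assumes "subspace W"
  shows "linear (orthogonal_projector W)"
proof (rule linearI)
  note proj = orthogonal_projector_in[OF assms] orthogonal_projector_residual[OF assms]
  fix x y
  have "(x - orthogonal_projector W x) + (y - orthogonal_projector W y) \<in> orthogonal_comp W"
    by (intro subspace_add subspace_orthogonal_comp proj)
  then show "orthogonal_projector W (x + y) = orthogonal_projector W x + orthogonal_projector W y"
    by (intro orthogonal_projector_unique assms subspace_add proj) (simp add: algebra_simps)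
next
  note proj = orthogonal_projector_in[OF assms] orthogonal_projector_residual[OF assms]
  fix c x
  have "c *\<^sub>R (x - orthogonal_projector W x) \<in> orthogonal_comp W"
    by (intro subspace_scale subspace_orthogonal_comp proj)
  then show "orthogonal_projector W (c *\<^sub>R x) = c *\<^sub>R orthogonal_projector W x"
    by (intro orthogonal_projector_unique assms subspace_scale proj) (simp add: algebra_simps)
qed


subsection \<open>The Frobenius inner product\<close>

text \<open>Left multiplication acts column by column, so this splitting reduces Frobenius
  identities and bounds to statements about single vectors.\<close>

lemma inner_eq_sum_columns:
  fixes X Y :: "real^'n::finite^'m::finite"
  shows "X \<bullet> Y = (\<Sum>k\<in>UNIV. column k X \<bullet> column k Y)"
  unfolding inner_vec_def column_def by (simp, rule sum.swap)

lemma column_matrix_mul: "column k (A ** B) = A *v column k B"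
  by (simp add: column_def matrix_matrix_mult_def matrix_vector_mult_def vec_eq_iff)

lemma inner_transpose_matrix_mul:
  fixes A :: "real^'n::finite^'m::finite"
  shows "X \<bullet> (transpose A ** Y) = (A ** X) \<bullet> Y"
proof -
  have "x \<bullet> (transpose A *v y) = (A *v x) \<bullet> y" for x y
    by (metis dot_lmul_matrix inner_commute transpose_matrix_vector)
  then show ?thesis
    by (simp add: inner_eq_sum_columns column_matrix_mul)
qed

lemma linear_matrix_mul_right: "linear (\<lambda>X :: real^'n::finite^'m::finite. A ** X)"
  by (rule linearI)
    (simp_all add: matrix_matrix_mult_def vec_eq_iff sum.distrib sum_distrib_left algebra_simps)

lemma diag_mat_mul: "(diag_mat c ** X) $ i = c i *\<^sub>R X $ i"
  by (simp add: diag_mat_def matrix_matrix_mult_def vec_eq_iff if_distrib[of "\<lambda>x. x * _"]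
      cong: if_cong)

lemma diag_mat_mul_vec: "(diag_mat c *v x) $ i = c i * x $ i"
  by (simp add: diag_mat_def matrix_vector_mult_def if_distrib[of "\<lambda>x. x * _"] cong: if_cong)

lemma inner_diag_mat_ge:
  fixes Y :: "real^'n::finite^'m::finite"
  assumes "\<And>i. a \<le> c i"
  shows "a * (norm Y)\<^sup>2 \<le> Y \<bullet> (diag_mat c ** Y)"
proof -
  have "a * (norm Y)\<^sup>2 = (\<Sum>i\<in>UNIV. a * (Y $ i \<bullet> Y $ i))"
    by (simp add: power2_norm_eq_inner inner_vec_def[of Y] sum_distrib_left)
  also have "\<dots> \<le> (\<Sum>i\<in>UNIV. c i * (Y $ i \<bullet> Y $ i))"
    by (intro sum_mono mult_right_mono assms) simp
  also have "\<dots> = Y \<bullet> (diag_mat c ** Y)"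
    by (simp add: inner_vec_def[of Y] diag_mat_mul)
  finally show ?thesis .
qed


subsection \<open>Rayleigh quotients\<close>

text \<open>A zero of the form is a minimum. Moving from \<open>x\<close> by \<open>t\<close> times
  \<open>M *v x\<close> changes the form to first order by twice \<open>t\<close> times the squared
  norm of \<open>M *v x\<close>, so a small negative \<open>t\<close> would make it negative unless
  \<open>M *v x\<close> vanishes.\<close>

lemma psd_quadratic_form_eq_0:
  fixes M :: "real^'n::finite^'n"
  assumes sym: "transpose M = M" and psd: "\<And>x. x \<bullet> (M *v x) \<ge> 0" and x: "x \<bullet> (M *v x) = 0"
  shows "M *v x = 0"
proof (rule ccontr)
  assume nz: "M *v x \<noteq> 0"
  define y where "y = M *v x"
  define b where "b = y \<bullet> y"
  define c where "c = y \<bullet> (M *v y)"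
  have b: "b > 0"
    using nz by (simp add: b_def y_def)
  have xy: "x \<bullet> (M *v y) = b"
    by (metis b_def dot_lmul_matrix sym transpose_matrix_vector y_def)
  have c: "c \<ge> 0"
    using psd by (simp add: c_def)
  \<comment> \<open>This \<open>t\<close> minimizes 2tb + t^2(c + 1), with value -b^2/(c + 1).
    Enlarging \<open>c\<close> by 1 keeps the denominator positive even if
    \<open>c = 0\<close>.\<close>
  define t where "t = - b / (c + 1)"
  have "0 \<le> (x + t *\<^sub>R y) \<bullet> (M *v (x + t *\<^sub>R y))"
    by (rule psd)
  also have "\<dots> = 2 * t * b + t\<^sup>2 * c"
    using x xy
    by (simp add: matrix_vector_right_distrib matrix_vector_mult_scaleR inner_add_left
        inner_add_right flip: y_def b_def c_def) (simp add: power2_eq_square algebra_simps)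
  also have "\<dots> \<le> 2 * t * b + t\<^sup>2 * (c + 1)"
    by (simp add: algebra_simps)
  also have "\<dots> = - (b\<^sup>2 / (c + 1))"
    using c by (simp add: t_def divide_simps power2_eq_square)
  also have "\<dots> < 0"
    using b c by simp
  finally show False by simp
qed

text \<open>Eigenvectors for distinct eigenvalues are orthogonal, so choosing one for each
  eigenvalue gives an independent and therefore finite set. Finiteness is what makes the
  \<open>Max\<close> in \<open>lambda_max\<close> meaningful.\<close>

lemma finite_eigenvalues_symmetric:
  fixes M :: "real^'n::finite^'n"
  assumes sym: "transpose M = M"
  shows "finite {l. eigenvalue M l}"
proof -
  define f where "f l = (SOME x. x \<noteq> 0 \<and> M *v x = l *\<^sub>R x)" for l
  have f: "f l \<noteq> 0 \<and> M *v f l = l *\<^sub>R f l" if "eigenvalue M l" for l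
    unfolding f_def by (rule someI_ex) (use that in \<open>simp add: eigenvalue_def\<close>)
  have orth: "f l \<bullet> f m = 0" if "eigenvalue M l" "eigenvalue M m" "l \<noteq> m" for l m
  proof -
    have "(M *v f l) \<bullet> f m = f l \<bullet> (M *v f m)"
      by (metis dot_lmul_matrix sym transpose_matrix_vector)
    then have "l * (f l \<bullet> f m) = m * (f l \<bullet> f m)"
      using f that by simp
    then show ?thesis
      using that(3) by simp
  qed
  have inj: "inj_on f {l. eigenvalue M l}"
  proof (rule inj_onI)
    fix l m assume lm: "l \<in> {l. eigenvalue M l}" "m \<in> {l. eigenvalue M l}" "f l = f m"
    show "l = m"
      by (rule ccontr) (use lm orth[of l m] f[of l] in auto)
  qed
  have "pairwise orthogonal (f ` {l. eigenvalue M l})"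
    using orth by (auto simp: pairwise_def orthogonal_def)
  moreover have "0 \<notin> f ` {l. eigenvalue M l}"
    using f by force
  ultimately have "finite (f ` {l. eigenvalue M l})"
    using pairwise_orthogonal_independent independent_imp_finite by blast
  then show ?thesis
    using inj finite_imageD by blast
qed

text \<open>
  The maximum \<open>m\<close> of the quadratic form on the unit sphere is an eigenvalue, since the
  maximizer annihilates the quadratic form of the positive semidefinite matrix \<open>m I - M\<close>.
\<close>

lemma quadratic_form_le_lambda_max:
  fixes M :: "real^'n::finite^'n"
  assumes sym: "transpose M = M"
  shows "x \<bullet> (M *v x) \<le> lambda_max M * (norm x)\<^sup>2"
proof -
  have "axis undefined 1 \<in> sphere (0 :: real^'n) 1"
    by simp
  then have ne: "sphere (0 :: real^'n) 1 \<noteq> {}"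
    by blast
  have "continuous_on (sphere 0 1) (\<lambda>x :: real^'n. x \<bullet> (M *v x))"
    by (intro continuous_intros linear_continuous_on matrix_vector_mul_bounded_linear)
  then obtain u :: "real^'n" where u: "norm u = 1"
      and max: "\<And>y. norm y = 1 \<Longrightarrow> y \<bullet> (M *v y) \<le> u \<bullet> (M *v u)"
    using continuous_attains_sup[OF compact_sphere ne, of "\<lambda>x. x \<bullet> (M *v x)"] by auto
  define m where "m = u \<bullet> (M *v u)"
  have bound: "y \<bullet> (M *v y) \<le> m * (norm y)\<^sup>2" for y
  proof (cases "y = 0")
    case False
    define z where "z = (1 / norm y) *\<^sub>R y"
    have "norm z = 1" and y: "y = norm y *\<^sub>R z"
      using False by (auto simp: z_def)
    have "y \<bullet> (M *v y) = (norm y)\<^sup>2 * (z \<bullet> (M *v z))"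
      by (subst (1 2) y) (simp add: matrix_vector_mult_scaleR power2_eq_square)
    also have "\<dots> \<le> (norm y)\<^sup>2 * m"
      using max[OF \<open>norm z = 1\<close>] by (intro mult_left_mono) (simp_all add: m_def)
    finally show ?thesis
      by (simp add: mult.commute)
  qed simp
  define N where "N = mat m - M"
  have N: "N *v y = m *\<^sub>R y - M *v y" for y
    by (simp add: N_def matrix_vector_mult_diff_rdistrib)
      (simp add: vec_eq_iff mat_def matrix_vector_mult_def if_distrib[of "\<lambda>x. x * _"] cong: if_cong)
  have "transpose N = N"
    using sym by (simp add: N_def vec_eq_iff transpose_def mat_def)
  moreover have "y \<bullet> (N *v y) \<ge> 0" for y
    using bound[of y] by (simp add: N inner_diff_right power2_norm_eq_inner)
  moreover have "u \<bullet> (N *v u) = 0"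
    using u by (simp add: N inner_diff_right m_def norm_eq_1)
  ultimately have "N *v u = 0"
    by (rule psd_quadratic_form_eq_0)
  then have "eigenvalue M m"
    using u unfolding eigenvalue_def by (intro exI[of _ u]) (auto simp: N)
  then have "m \<le> lambda_max M"
    unfolding lambda_max_def using finite_eigenvalues_symmetric[OF sym] by (intro Max_ge) auto
  then show ?thesis
    using bound[of x] by (meson mult_right_mono order_trans zero_le_power2)
qed

lemma frobenius_quadratic_form_le_lambda_max:
  fixes M :: "real^'n::finite^'n" and X :: "real^'d::finite^'n"
  assumes "transpose M = M"
  shows "X \<bullet> (M ** X) \<le> lambda_max M * (norm X)\<^sup>2"
proof -
  have "X \<bullet> (M ** X) \<le> (\<Sum>k\<in>UNIV. lambda_max M * (norm (column k X))\<^sup>2)"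
    unfolding inner_eq_sum_columns column_matrix_mul
    by (intro sum_mono quadratic_form_le_lambda_max assms)
  also have "\<dots> = lambda_max M * (norm X)\<^sup>2"
    by (simp add: power2_norm_eq_inner inner_eq_sum_columns[of X] sum_distrib_left)
  finally show ?thesis .
qed


subsection \<open>The kernel of the gradient matrix\<close>

lemma weighted_hypergraph_ex_other_node:
  fixes E :: "'v::finite set set" and v :: 'v
  assumes "weighted_hypergraph E \<omega>"
  shows "\<exists>u. u \<noteq> v"
proof (rule ccontr)
  assume "\<not> ?thesis"
  then have "(UNIV :: 'v set) = {v}" by auto
  then have "CARD('v) = 1" by (metis card.empty card.insert empty_iff finite.emptyI One_nat_def)
  then show False
    using assms by (simp add: weighted_hypergraph_def)
qed

text \<open>A path from \<open>v\<close> to some other node starts inside a hyperedge containing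
  \<open>v\<close>. Positivity makes the divisions by square roots of degrees genuine.\<close>

lemma degree_pos:
  fixes E :: "'v::finite set set"
  assumes "weighted_hypergraph E \<omega>" "connected_hypergraph E"
  shows "degree E v > 0"
proof -
  obtain u where "u \<noteq> v"
    using weighted_hypergraph_ex_other_node[OF assms(1)] by blast
  moreover have "(v, u) \<in> {(x, y). \<exists>e\<in>E. x \<in> e \<and> y \<in> e}\<^sup>*"
    using assms(2) by (simp add: connected_hypergraph_def)
  ultimately obtain e where "e \<in> E" "v \<in> e"
    by (auto elim: converse_rtranclE)
  then have "{e \<in> E. v \<in> e} \<noteq> {}"
    by blast
  then show ?thesis
    by (simp add: degree_def card_gt_0_iff)
qed

lemma P_op_linear: "Vector_Spaces.linear (*s) (*s) (P_op E inc)"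
  unfolding Vector_Spaces.linear_iff
  by (auto simp: P_op_def vec_eq_iff sum.distrib add_divide_distrib
      sum_distrib_left sum_divide_distrib split_beta algebra_simps
      vec.vector_space_axioms)

lemma gradient_matrix_mul:
  assumes "inc i = (e, v)"
  shows "(gradient_matrix E \<omega> inc ** Z) $ i $ k = sqrt (\<omega> e) *
    (Z $ v $ k / sqrt (degree E v) - (1 / card e) * (\<Sum>u\<in>e. Z $ u $ k / sqrt (degree E u)))"
proof -
  have "(gradient_matrix E \<omega> inc ** Z) $ i $ k = column k (gradient_matrix E \<omega> inc ** Z) $ i"
    by (simp add: column_def)
  also have "\<dots> = sqrt (\<omega> e) * P_op E inc (column k Z) $ i"
    using assms
    by (simp add: column_matrix_mul gradient_matrix_def diag_mat_mul_vec
        matrix_works[OF P_op_linear] flip: matrix_vector_mul_assoc)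
  finally show ?thesis
    using assms by (simp add: P_op_def column_def)
qed

lemma null_mode_nth: "null_mode E $ v = sqrt (degree E v)"
  by (simp add: null_mode_def diag_mat_mul_vec)

lemma subspace_null_space:
  fixes E :: "'v::finite set set"
  shows "subspace (null_space E :: (real^'d::finite^'v) set)"
proof -
  have "linear (\<lambda>c :: real^'d. (\<chi> v k. null_mode E $ v * c $ k) :: real^'d^'v)"
    by (rule linearI) (simp_all add: vec_eq_iff algebra_simps)
  then show ?thesis
    unfolding null_space_def by (simp add: linear_subspace_image)
qed

text \<open>After rescaling row \<open>u\<close> by the inverse square root of its degree, a zero
  row of the product says that the value at \<open>v\<close> equals the mean over \<open>e\<close>.
  Rescaled values are then constant on each hyperedge, and connectedness makes them constant on all
  nodes.\<close>

lemma gradient_matrix_mul_eq_0_iff: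
  fixes E :: "'v::finite set set" and Z :: "real^'d::finite^'v"
  assumes hg: "weighted_hypergraph E \<omega>" and conn: "connected_hypergraph E"
    and inc: "bij_betw inc UNIV (incidences E)"
  shows "gradient_matrix E \<omega> inc ** Z = 0 \<longleftrightarrow> Z \<in> null_space E"
proof
  have deg: "sqrt (degree E v) > 0" for v
    using degree_pos[OF hg conn, of v] by simp
  show "gradient_matrix E \<omega> inc ** Z = 0" if ZN: "Z \<in> null_space E"
  proof -
    obtain c :: "real^'d" where Z: "Z = (\<chi> v k. null_mode E $ v * c $ k)"
      using ZN unfolding null_space_def by blast
    have "(gradient_matrix E \<omega> inc ** Z) $ i $ k = 0" for i k
    proof -
      obtain e v where ev: "inc i = (e, v)" by fastforce
      then have "e \<in> E"
        using inc by (metis (mono_tags, lifting) UNIV_I bij_betwE case_prodD incidences_def mem_Collect_eq)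
      \<comment> \<open>Nonemptiness of \<open>e\<close> ensures that the average of a constant over
        \<open>e\<close> is that constant.\<close>
      then have "card e \<noteq> 0"
        using hg by (fastforce simp: weighted_hypergraph_def)
      then have "e \<noteq> {}"
        by auto
      moreover have "Z $ u $ k / sqrt (degree E u) = c $ k" for u
        using deg[of u] by (simp add: Z null_mode_nth)
      ultimately show ?thesis
        by (simp add: gradient_matrix_mul[of inc i, OF ev])
    qed
    then show ?thesis
      by (simp add: vec_eq_iff)
  qed
  show "Z \<in> null_space E" if G0: "gradient_matrix E \<omega> inc ** Z = 0"
  proof -
    define f where "f u k = Z $ u $ k / sqrt (degree E u)" for u k
    \<comment> \<open>The positive factor \<open>sqrt (\<omega> e)\<close> cancels from the
      vanishing row of the incidence \<open>(e, v)\<close>.\<close>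
    have mean: "f v k = (1 / card e) * (\<Sum>u\<in>e. f u k)" if "e \<in> E" "v \<in> e" for e v k
    proof -
      have "(e, v) \<in> incidences E"
        using that by (simp add: incidences_def)
      then obtain i where "inc i = (e, v)"
        using inc by (metis (no_types, lifting) bij_betw_imp_surj_on imageE)
      moreover have "\<omega> e > 0"
        using hg that by (simp add: weighted_hypergraph_def)
      ultimately show ?thesis
        using gradient_matrix_mul[of inc i e v E \<omega> Z k] G0 by (simp add: f_def)
    qed
    have step: "f x k = f y k" if xy: "(x, y) \<in> {(x, y). \<exists>e\<in>E. x \<in> e \<and> y \<in> e}" for x y k
    proof -
      obtain e where "e \<in> E" "x \<in> e" "y \<in> e"
        using xy by blast
      then show ?thesis
        using mean[of e x k] mean[of e y k] by simp
    qed
    have const: "f x k = f y k" for x y k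
    proof -
      have "(x, y) \<in> {(x, y). \<exists>e\<in>E. x \<in> e \<and> y \<in> e}\<^sup>*"
        using conn by (simp add: connected_hypergraph_def)
      then show ?thesis
        by (induction rule: rtrancl_induct) (use step in auto)
    qed
    \<comment> \<open>The rescaled values agree at all nodes, so \<open>undefined\<close> serves as
      an arbitrary reference node.\<close>
    have "Z = (\<chi> v k. null_mode E $ v * (\<chi> k. f undefined k) $ k)"
    proof -
      have "Z $ v $ k = sqrt (degree E v) * f undefined k" for v k
        using deg[of v] const[of undefined k v] by (simp add: f_def)
      then show ?thesis
        by (simp add: vec_eq_iff null_mode_nth)
    qed
    then show ?thesis
      unfolding null_space_def by blast
  qed
qed


subsection \<open>The spectral gap\<close>

text \<open>Ensures that the minimum defining \<open>lambda2\<close> ranges over a nonempty set;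
  this is where having two nodes matters.\<close>

lemma orthogonal_comp_null_space_nontrivial:
  fixes E :: "'v::finite set set"
  assumes hg: "weighted_hypergraph E \<omega>" and conn: "connected_hypergraph E"
  shows "\<exists>Z \<in> orthogonal_comp (null_space E :: (real^'d::finite^'v) set). norm Z = 1"
proof -
  obtain u v :: 'v where uv: "u \<noteq> v"
    using weighted_hypergraph_ex_other_node[OF hg] by blast
  \<comment> \<open>Exchanging the square roots of the two degrees, with opposite signs, makes both
    contributions to the pairing with the null mode equal to \<open>p\<close> up to sign, so they
    cancel.\<close>
  define h where "h w = (if w = u then sqrt (degree E v) else 0) -
      (if w = v then sqrt (degree E u) else 0)" for w
  define Z where "Z = ((\<chi> w k. h w) :: real^'d^'v)"
  define p where "p = sqrt (degree E u) * sqrt (degree E v)"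
  have "sqrt (degree E w) * h w = (if w = u then p else 0) - (if w = v then p else 0)" for w
    by (simp add: h_def p_def)
  then have "(\<Sum>w\<in>UNIV. sqrt (degree E w) * h w) = 0"
    by (simp add: sum_subtractf)
  then have *: "(\<Sum>w\<in>UNIV. sqrt (degree E w) * c * h w) = 0" for c
    by (simp add: mult.assoc mult.left_commute[of _ c] flip: sum_distrib_left)
  have orth: "(\<chi> v k. null_mode E $ v * c $ k) \<bullet> Z = 0" for c
    unfolding inner_eq_sum_columns inner_vec_def[where 'a = real] column_def
    by (simp add: Z_def null_mode_nth) (simp add: *)
  then have Z: "Z \<in> orthogonal_comp (null_space E)"
    by (auto simp: orthogonal_comp_def orthogonal_def null_space_def)
  have "Z $ u $ k \<noteq> 0" for k
    using uv degree_pos[OF hg conn, of v] by (simp add: Z_def h_def)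
  then have "Z \<noteq> 0"
    by auto
  then show ?thesis
    using Z by (intro bexI[of _ "(1 / norm Z) *\<^sub>R Z"])
      (auto intro: subspace_scale subspace_orthogonal_comp)
qed

text \<open>Both claims come from one minimizer on the compact unit sphere of the complement. A zero
  minimum would put the minimizer in the null space as well, contradicting its unit norm; the
  inequality follows by scaling.\<close>

lemma
  fixes E :: "'v::finite set set" and \<omega> :: "'v set \<Rightarrow> real" and inc :: "'i::finite \<Rightarrow> 'v set \<times> 'v"
  assumes hg: "weighted_hypergraph E \<omega>" and conn: "connected_hypergraph E"
    and inc: "bij_betw inc UNIV (incidences E)"
  shows lambda2_pos: "lambda2 TYPE('d::finite) E \<omega> inc > 0"
    and lambda2_mul_norm_le:
      "\<And>Z :: real^'d^'v. Z \<in> orthogonal_comp (null_space E) \<Longrightarrow>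
        lambda2 TYPE('d) E \<omega> inc * (norm Z)\<^sup>2 \<le> (norm (gradient_matrix E \<omega> inc ** Z))\<^sup>2"
proof -
  define G where "G = gradient_matrix E \<omega> inc"
  define W where "W = (null_space E :: (real^'d^'v) set)"
  define K where "K = {Z \<in> orthogonal_comp W. norm Z = 1}"
  have "K = orthogonal_comp W \<inter> sphere 0 1"
    by (auto simp: K_def)
  then have "compact K"
    using compact_Int_closed[OF compact_sphere closed_subspace[OF subspace_orthogonal_comp]]
    by (metis inf_commute)
  moreover have "K \<noteq> {}"
    using orthogonal_comp_null_space_nontrivial[OF hg conn] by (auto simp: K_def W_def)
  moreover have "continuous_on K (\<lambda>Z. (norm (G ** Z))\<^sup>2)"
    using linear_continuous_on[OF linear_matrix_mul_right[of G, THEN linear_conv_bounded_linear[THEN iffD1]]]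
    by (intro continuous_intros)
  ultimately obtain Z0 where Z0: "Z0 \<in> K"
      and min: "\<And>Z. Z \<in> K \<Longrightarrow> (norm (G ** Z0))\<^sup>2 \<le> (norm (G ** Z))\<^sup>2"
    by (metis continuous_attains_inf)
  have lambda2: "lambda2 TYPE('d) E \<omega> inc = (norm (G ** Z0))\<^sup>2"
    unfolding lambda2_def
    by (rule Least_equality) (use Z0 min in \<open>auto simp: K_def G_def W_def\<close>)
  have "G ** Z0 \<noteq> 0"
  proof
    assume "G ** Z0 = 0"
    then have "Z0 \<in> W"
      by (simp add: G_def W_def gradient_matrix_mul_eq_0_iff[OF hg conn inc])
    then have "orthogonal Z0 Z0"
      using Z0 by (auto simp: K_def orthogonal_comp_def)
    then show False
      using Z0 by (auto simp: K_def orthogonal_self)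
  qed
  then show "lambda2 TYPE('d::finite) E \<omega> inc > 0"
    by (simp add: lambda2)
  show "lambda2 TYPE('d) E \<omega> inc * (norm Z)\<^sup>2 \<le> (norm (gradient_matrix E \<omega> inc ** Z))\<^sup>2"
    if Z: "Z \<in> orthogonal_comp (null_space E)" for Z :: "real^'d^'v"
  proof (cases "Z = 0")
    case False
    define Y where "Y = (1 / norm Z) *\<^sub>R Z"
    have ZY: "Z = norm Z *\<^sub>R Y"
      using False by (simp add: Y_def)
    have "Y \<in> K"
      using False Z by (auto simp: K_def W_def Y_def intro: subspace_scale subspace_orthogonal_comp)
    then have "(norm (G ** Z0))\<^sup>2 * (norm Z)\<^sup>2 \<le> (norm (G ** Y))\<^sup>2 * (norm Z)\<^sup>2"
      by (intro mult_right_mono min) auto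
    also have "\<dots> = (norm (G ** Z))\<^sup>2"
      by (subst (2) ZY) (simp add: linear_scale[OF linear_matrix_mul_right] power_mult_distrib)
    finally show ?thesis
      by (simp add: lambda2 G_def)
  qed simp
qed


subsection \<open>Modulation\<close>

lemma max_degree_ge: "degree E v \<le> max_degree E"
  by (simp add: max_degree_def)

lemma a_min_pos:
  assumes "weighted_hypergraph E \<omega>" "connected_hypergraph E" "0 < \<epsilon>"
  shows "a_min E \<epsilon> > 0"
proof -
  have "0 < degree E undefined"
    by (rule degree_pos[OF assms(1,2)])
  also have "\<dots> \<le> max_degree E"
    by (rule max_degree_ge)
  finally show ?thesis
    using assms(3) by (simp add: a_min_def)
qed

text \<open>The softmax term is nonnegative, which leaves the uniform floor
  \<open>\<epsilon> / degree E v\<close>.\<close>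

lemma modulation_ge_a_min:
  assumes "weighted_hypergraph E \<omega>" "connected_hypergraph E" "0 < \<epsilon>" "\<epsilon> < 1"
  shows "a_min E \<epsilon> \<le> modulation E \<epsilon> \<alpha> F agg X e v"
proof -
  have "a_min E \<epsilon> \<le> \<epsilon> / degree E v"
    unfolding a_min_def using degree_pos[OF assms(1,2), of v] max_degree_ge[of E v] assms(3)
    by (intro divide_left_mono) auto
  also have "\<dots> \<le> modulation E \<epsilon> \<alpha> F agg X e v"
    using assms(4) by (auto simp: modulation_def intro!: divide_nonneg_nonneg sum_nonneg mult_nonneg_nonneg)
  finally show ?thesis .
qed


subsection \<open>Energy decay along solutions\<close>

text \<open>Gronwall's inequality: multiplying by the integrating factor \<open>exp (c * s)\<close>
  turns the differential inequality into monotonicity.\<close>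

lemma exponential_decay:
  fixes h :: "real \<Rightarrow> real"
  assumes deriv: "\<And>t. t \<ge> 0 \<Longrightarrow> (h has_real_derivative h' t) (at t within {0..})"
    and le: "\<And>t. t \<ge> 0 \<Longrightarrow> h' t \<le> - c * h t"
    and t: "t \<ge> 0"
  shows "h t \<le> exp (- c * t) * h 0"
proof -
  define g where "g s = exp (c * s) * h s" for s
  have g: "(g has_real_derivative exp (c * s) * (c * h s + h' s)) (at s within {0..})" if "s \<ge> 0" for s
    unfolding g_def using deriv[OF that]
    by (auto intro!: derivative_eq_intros simp: algebra_simps)
  have "g t \<le> g 0"
  \<comment> \<open>At 0 only a one-sided derivative is available, so derivatives are used on the
    open interval and continuity up to the endpoints.\<close>
  proof (rule DERIV_nonpos_imp_decreasing_open[OF t])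
    fix s :: real assume s: "0 < s"
    then have "(g has_real_derivative exp (c * s) * (c * h s + h' s)) (at s)"
      using g[of s] at_within_interior[of s "{0..}"] by (simp add: interior_Ici[of "-1"])
    moreover have "exp (c * s) * (c * h s + h' s) \<le> 0"
      using le[of s] s by (intro mult_nonneg_nonpos) auto
    ultimately show "\<exists>y. (g has_real_derivative y) (at s) \<and> y \<le> 0"
      by blast
  next
    have "continuous_on {0..} g"
      using g by (intro continuous_on_eq_continuous_within[THEN iffD2]) (auto intro: DERIV_continuous)
    then show "continuous_on {0..t} g"
      by (rule continuous_on_subset) auto
  qed
  then have "exp (- c * t) * (exp (c * t) * h t) \<le> exp (- c * t) * h 0"
    by (simp add: g_def)
  then show ?thesis
    by (simp flip: mult.assoc exp_add)
qed

lemma linear_Q_proj: "linear (Q_proj E)"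
  unfolding Q_proj_def
  by (intro linear_compose_sub linear_ident linear_orthogonal_projector subspace_null_space)

lemma Q_proj_orthogonal: "Q_proj E X \<in> orthogonal_comp (null_space E)"
  unfolding Q_proj_def by (intro orthogonal_projector_residual subspace_null_space)

lemma diff_Q_proj_in: "X - Q_proj E X \<in> null_space E"
  by (simp add: Q_proj_def orthogonal_projector_in subspace_null_space)

text \<open>The part of \<open>Y\<close> removed by the projection lies in the null space,
  orthogonal to \<open>Q_proj E X\<close>.\<close>

lemma inner_Q_proj_Q_proj: "Q_proj E X \<bullet> Q_proj E Y = Q_proj E X \<bullet> Y"
proof -
  have "(Y - Q_proj E Y) \<bullet> Q_proj E X = 0"
    using Q_proj_orthogonal[of E X] diff_Q_proj_in[of Y E]
    by (simp add: orthogonal_comp_def orthogonal_def)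
  then show ?thesis
    by (simp add: inner_diff_left inner_diff_right inner_commute)
qed

text \<open>Moving the transposed gradient across the inner product turns the left side into minus a
  quadratic form in \<open>Y\<close>; the modulation floor and then the spectral gap bound that form
  from below.\<close>

lemma dissipation:
  fixes E :: "'v::finite set set" and \<omega> :: "'v set \<Rightarrow> real" and inc :: "'i::finite \<Rightarrow> 'v set \<times> 'v"
    and X :: "real^'d::finite^'v"
  assumes hg: "weighted_hypergraph E \<omega>" and conn: "connected_hypergraph E"
    and inc: "bij_betw inc UNIV (incidences E)" and eps: "0 < \<epsilon>" "\<epsilon> < 1"
  shows "Q_proj E X \<bullet> diffusion_field E \<omega> inc \<epsilon> \<alpha> F agg X
    \<le> - gamma_D TYPE('d) E \<omega> inc \<epsilon> * (norm (Q_proj E X))\<^sup>2"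
proof -
  define G where "G = gradient_matrix E \<omega> inc"
  define A where "A = modulation_matrix E inc \<epsilon> \<alpha> F agg X"
  define Y where "Y = G ** Q_proj E X"
  \<comment> \<open>The gradient does not see the null component, so \<open>X\<close> may be
    replaced by its projection under \<open>G\<close>, while \<open>A\<close> is still evaluated at
    \<open>X\<close> itself.\<close>
  have "G ** (X - Q_proj E X) = 0"
    unfolding G_def gradient_matrix_mul_eq_0_iff[OF hg conn inc] by (rule diff_Q_proj_in)
  then have GX: "G ** X = Y"
    by (simp add: Y_def linear_diff[OF linear_matrix_mul_right])
  have "gamma_D TYPE('d) E \<omega> inc \<epsilon> * (norm (Q_proj E X))\<^sup>2 \<le> a_min E \<epsilon> * (norm Y)\<^sup>2"
    using lambda2_mul_norm_le[OF hg conn inc Q_proj_orthogonal, of X] a_min_pos[OF hg conn eps(1)]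
    by (simp add: gamma_D_def Y_def G_def mult.assoc)
  also have "\<dots> \<le> Y \<bullet> (A ** Y)"
    unfolding A_def modulation_matrix_def
    by (intro inner_diag_mat_ge modulation_ge_a_min[OF hg conn eps])
  also have "\<dots> = - (Q_proj E X \<bullet> diffusion_field E \<omega> inc \<epsilon> \<alpha> F agg X)"
    by (simp add: diffusion_field_def GX inner_transpose_matrix_mul flip: G_def A_def Y_def)
  finally show ?thesis by simp
qed

lemma norm_Q_proj_solution_le:
  fixes E :: "'v::finite set set" and \<omega> :: "'v set \<Rightarrow> real" and inc :: "'i::finite \<Rightarrow> 'v set \<times> 'v"
    and x :: "real \<Rightarrow> real^'d::finite^'v"
  assumes hg: "weighted_hypergraph E \<omega>" and conn: "connected_hypergraph E"
    and inc: "bij_betw inc UNIV (incidences E)" and eps: "0 < \<epsilon>" "\<epsilon> < 1"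
    and sol: "classical_solution (diffusion_field E \<omega> inc \<epsilon> \<alpha> F agg) x0 x"
    and t: "t \<ge> 0"
  shows "(norm (Q_proj E (x t)))\<^sup>2
    \<le> exp (- 2 * gamma_D TYPE('d) E \<omega> inc \<epsilon> * t) * (norm (Q_proj E x0))\<^sup>2"
proof -
  define f where "f = diffusion_field E \<omega> inc \<epsilon> \<alpha> F agg"
  define h where "h s = Q_proj E (x s) \<bullet> Q_proj E (x s)" for s
  have "(h has_real_derivative 2 * (Q_proj E (x s) \<bullet> f (x s))) (at s within {0..})"
    if "s \<ge> 0" for s
  proof -
    have "(x has_vector_derivative f (x s)) (at s within {0..})"
      using sol that by (simp add: classical_solution_def f_def)
    then have Q: "((\<lambda>s. Q_proj E (x s)) has_vector_derivative Q_proj E (f (x s))) (at s within {0..})"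
      using linear_Q_proj linear_conv_bounded_linear
      by (blast intro: bounded_linear.has_vector_derivative)
    \<comment> \<open>The product rule yields the projected field twice;
      \<open>inner_Q_proj_Q_proj\<close> then removes the projection from the field.\<close>
    show ?thesis
      using bounded_bilinear.has_vector_derivative[OF bounded_bilinear_inner Q Q]
      by (simp add: h_def[abs_def] has_real_derivative_iff_has_vector_derivative inner_commute
          inner_Q_proj_Q_proj[of E "x s"])
  qed
  moreover have "2 * (Q_proj E (x s) \<bullet> f (x s)) \<le> - (2 * gamma_D TYPE('d) E \<omega> inc \<epsilon>) * h s" for s
    using dissipation[OF hg conn inc eps, of "x s" \<alpha> F agg]
    by (simp add: f_def h_def power2_norm_eq_inner)
  ultimately have "h t \<le> exp (- (2 * gamma_D TYPE('d) E \<omega> inc \<epsilon>) * t) * h 0"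
    by (rule exponential_decay) (use t in auto)
  moreover have "x 0 = x0"
    using sol by (simp add: classical_solution_def)
  ultimately show ?thesis
    by (simp add: h_def power2_norm_eq_inner)
qed

theorem theorem4:
  fixes E :: "'v::finite set set"
    and \<omega> :: "'v set \<Rightarrow> real"
    and inc :: "'i::finite \<Rightarrow> 'v set \<times> 'v"
    and agg :: "(real^'d::finite) multiset \<Rightarrow> real^'d"
    and \<psi> :: "nat \<Rightarrow> real \<Rightarrow> real"
    and \<theta> :: "('d + 'd) mlp_params"
    and \<alpha> \<epsilon> :: real
    and S :: "real \<Rightarrow> real^'d^'v \<Rightarrow> real^'d^'v"
    and L :: "real^'v^'v"
  assumes hypergraph: "weighted_hypergraph E \<omega>"
    and connected: "connected_hypergraph E"
    and incidence: "bij_betw inc UNIV (incidences E)"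
    and eps: "0 < \<epsilon>" "\<epsilon> < 1"
    and slope: "0 < \<alpha>" "\<alpha> < 1"
    and agg: "locally_lipschitz_aggregator TYPE('v) agg"
    and params: "wf_mlp_params \<theta>"
    and mlp: "locally_lipschitz (mlp \<psi> \<theta>)"
    and semiflow: "semiflow_generated_by (diffusion_field E \<omega> inc \<epsilon> \<alpha> (mlp \<psi> \<theta>) agg) S"
    and L_sym: "transpose L = L"
    and L_psd: "\<forall>x. x \<bullet> (L *v x) \<ge> 0"
    and L_phi: "L *v null_mode E = 0"
    and L_ker: "{x. L *v x = 0} = span {null_mode E}"
  shows "lambda2 TYPE('d) E \<omega> inc > 0 \<and> gamma_D TYPE('d) E \<omega> inc \<epsilon> > 0 \<and>
    (\<forall>X0. ((\<lambda>t. dirichlet_energy E L (S t X0)) \<longlongrightarrow> 0) at_top) \<and>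
    (\<forall>X0. \<forall>t\<ge>0. dirichlet_energy E L (S t X0)
            \<le> 1/2 * lambda_max L * exp (- 2 * gamma_D TYPE('d) E \<omega> inc \<epsilon> * t) * (norm (Q_proj E X0))\<^sup>2) \<and>
    (\<forall>X0. ((\<lambda>t. dirichlet_energy E L (S t X0)) \<longlongrightarrow> 0) at_top \<longleftrightarrow>
          ((\<lambda>t. infdist (S t X0) (null_space E)) \<longlongrightarrow> 0) at_top)"
proof -
  define \<gamma> where "\<gamma> = gamma_D TYPE('d) E \<omega> inc \<epsilon>"
  have lambda2: "lambda2 TYPE('d) E \<omega> inc > 0"
    by (rule lambda2_pos[OF hypergraph connected incidence])
  then have \<gamma>: "\<gamma> > 0"
    using a_min_pos[OF hypergraph connected eps(1)] by (simp add: \<gamma>_def gamma_D_def)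
  have Q: "(norm (Q_proj E (S t X0)))\<^sup>2 \<le> exp (- 2 * \<gamma> * t) * (norm (Q_proj E X0))\<^sup>2"
    if "t \<ge> 0" for t X0
    unfolding \<gamma>_def
  proof (rule norm_Q_proj_solution_le[OF hypergraph connected incidence eps _ that])
    show "classical_solution (diffusion_field E \<omega> inc \<epsilon> \<alpha> (mlp \<psi> \<theta>) agg) X0 (\<lambda>t. S t X0)"
      using semiflow by (simp add: semiflow_generated_by_def)
  qed
  have le: "dirichlet_energy E L X \<le> 1/2 * lambda_max L * (norm (Q_proj E X))\<^sup>2"
    for X :: "real^'d^'v"
    using frobenius_quadratic_form_le_lambda_max[OF L_sym, of "Q_proj E X"]
    by (simp add: dirichlet_energy_def)
  have nonneg: "dirichlet_energy E L X \<ge> 0" for X :: "real^'d^'v"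
    unfolding dirichlet_energy_def inner_eq_sum_columns column_matrix_mul
    using L_psd by (auto intro: sum_nonneg)
  \<comment> \<open>Testing on a unit vector shows \<open>lambda_max L\<close> to be nonnegative, so
    multiplying the decay estimate by it preserves the inequality.\<close>
  have "0 \<le> axis undefined 1 \<bullet> (L *v axis undefined 1)"
    using L_psd by blast
  also have "\<dots> \<le> lambda_max L"
    using quadratic_form_le_lambda_max[OF L_sym, of "axis undefined 1"] by simp
  finally have lmax: "lambda_max L \<ge> 0" .
  have bound: "dirichlet_energy E L (S t X0)
      \<le> 1/2 * lambda_max L * exp (- 2 * \<gamma> * t) * (norm (Q_proj E X0))\<^sup>2" if "t \<ge> 0" for t X0
  proof -
    have "1/2 * lambda_max L * (norm (Q_proj E (S t X0)))\<^sup>2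
        \<le> 1/2 * lambda_max L * (exp (- 2 * \<gamma> * t) * (norm (Q_proj E X0))\<^sup>2)"
      using lmax by (intro mult_left_mono Q that) auto
    then show ?thesis
      using le[of "S t X0"] by (simp add: mult.assoc)
  qed
  have exp0: "((\<lambda>t. exp (- 2 * \<gamma> * t)) \<longlongrightarrow> 0) at_top"
    using filterlim_compose[OF exp_at_bot
        filterlim_tendsto_neg_mult_at_bot[OF tendsto_const[of "- 2 * \<gamma>"] _ filterlim_ident]] \<gamma>
    by simp
  have lim: "((\<lambda>t. exp (- 2 * \<gamma> * t) * c) \<longlongrightarrow> 0) at_top" for c
    by (rule tendsto_mult_left_zero[OF exp0])
  have Q0: "((\<lambda>t. norm (Q_proj E (S t X0))) \<longlongrightarrow> 0) at_top" for X0
  proof -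
    have "((\<lambda>t. (norm (Q_proj E (S t X0)))\<^sup>2) \<longlongrightarrow> 0) at_top"
    proof (rule tendsto_sandwich[OF _ _ tendsto_const lim])
      show "\<forall>\<^sub>F t in at_top. (norm (Q_proj E (S t X0)))\<^sup>2
          \<le> exp (- 2 * \<gamma> * t) * (norm (Q_proj E X0))\<^sup>2"
        using eventually_ge_at_top[of 0] by eventually_elim (rule Q)
    qed simp
    from tendsto_real_sqrt[OF this] show ?thesis
      by simp
  qed
  have energy0: "((\<lambda>t. dirichlet_energy E L (S t X0)) \<longlongrightarrow> 0) at_top" for X0
  proof (rule tendsto_sandwich[OF _ _ tendsto_const lim])
    show "\<forall>\<^sub>F t in at_top. dirichlet_energy E L (S t X0)
        \<le> exp (- 2 * \<gamma> * t) * (1/2 * lambda_max L * (norm (Q_proj E X0))\<^sup>2)"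
      using eventually_ge_at_top[of 0]
      by eventually_elim (use bound in \<open>simp add: mult_ac\<close>)
  qed (simp add: nonneg)
  have dist0: "((\<lambda>t. infdist (S t X0) (null_space E)) \<longlongrightarrow> 0) at_top" for X0
  proof (rule tendsto_sandwich[OF _ _ tendsto_const Q0])
    \<comment> \<open>The point \<open>X - Q_proj E X\<close> of the null space lies at distance
      \<open>norm (Q_proj E X)\<close> from \<open>X\<close>.\<close>
    have "infdist X (null_space E) \<le> norm (Q_proj E X)" for X :: "real^'d^'v"
      using infdist_le[OF diff_Q_proj_in[of X E], of X] by (simp add: dist_norm)
    then show "\<forall>\<^sub>F t in at_top. infdist (S t X0) (null_space E) \<le> norm (Q_proj E (S t X0))"
      by simp
  qed (simp add: infdist_nonneg)
  show ?thesis
    using lambda2 \<gamma> energy0 dist0 bound unfolding \<gamma>_def by blast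
qed

end
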